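(* Let $X$ be an infinite-dimensional real Banach space and $I=[0,a]$ with $a>0$. Assume that $G\subset R(I,X)$ is a nonempty separable equi-regulated set with $\sup_{g\in G}\|g(t)\|<\infty$ for almost all $t\in I$. Then the mapping $\mathbb J_G:I\to C_b(\Omega)$ is strongly measurable.
   Context: A function $f:[0,a]\to X$ is regulated if for every $t\in[0,a)$ the right limit $\lim_{s\to t^+}f(s)$ exists and for every $t\in(0,a]$ the left limit $\lim_{s\to t^-}f(s)$ exists. $R(I,X)$ is the Banach space of all regulated functions on $I=[0,a]$ with the sup-norm. A nonempty $G\subset R(I,X)$ is equi-regulated if: for all $t\in(0,a]$ and $\varepsilon>0$ there is $\delta>0$ such that $\|g(t_2)-g(t_1)\|\le\varepsilon$ for all $g\in G$ and all $t_1,t_2\in(t-\delta,t)\cap[0,a]$; and for all $t\in[0,a)$ and $\varepsilon>0$ there is $\delta>0$ such that $\|g(t_2)-g(t_1)\|\le\varepsilon$ for all $g\in G$ and all $t_1,t_2\in(t,t+\delta)\cap[0,a]$. $\Omega=B_{X^*}$ with the norm topology, $C_b(\Omega)$ is the Banach space of bounded continuous real functions on $\Omega$ with the sup-norm. $\mathbb J_G$ is defined (for a.e. $t$) by $\mathbb J_G(t)(x^* )=\sup_{g\in G}\langle x^*,g(t)\rangle$, $x^*\in\Omega$. Strongly measurable (for Lebesgue measure on $I$) means being the a.e. norm-limit of a sequence of simple functions. *)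

theory Defs
  imports "HOL-Analysis.Analysis"
begin

section \<open>Regulated functions\<close>

text \<open>
  Functions on \<open>[0,a]\<close> are modelled as extensional functions on the real line, so that equality of
  functions is equality on \<open>[0,a]\<close>.
\<close>

definition regulated :: "real \<Rightarrow> (real \<Rightarrow> 'a::real_normed_vector) set" where
  "regulated a = {f \<in> extensional {0..a}.
     (\<forall>t\<in>{0..<a}. \<exists>l. (f \<longlongrightarrow> l) (at_right t)) \<and>
     (\<forall>t\<in>{0<..a}. \<exists>l. (f \<longlongrightarrow> l) (at_left t))}"

text \<open>
  The space \<open>R([0,a],X)\<close> with the metric of the sup-norm, as a subspace of the bounded functions;
  \<open>mspace_regulated_space\<close> and \<open>mdist_regulated_space\<close> below show that carrier and distance are the
  intended ones.
\<close>

definition regulated_space :: "real \<Rightarrow> (real \<Rightarrow> 'a::real_normed_vector) metric" where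
  "regulated_space a = submetric (funspace {0..a} euclidean_metric) (regulated a)"

definition equi_regulated :: "real \<Rightarrow> (real \<Rightarrow> 'a::real_normed_vector) set \<Rightarrow> bool" where
  "equi_regulated a G \<longleftrightarrow>
     G \<noteq> {} \<and> G \<subseteq> regulated a \<and>
     (\<forall>t\<in>{0<..a}. \<forall>\<epsilon>>0. \<exists>\<delta>>0. \<forall>g\<in>G.
        \<forall>t1\<in>{t-\<delta><..<t} \<inter> {0..a}. \<forall>t2\<in>{t-\<delta><..<t} \<inter> {0..a}. norm (g t2 - g t1) \<le> \<epsilon>) \<and>
     (\<forall>t\<in>{0..<a}. \<forall>\<epsilon>>0. \<exists>\<delta>>0. \<forall>g\<in>G.
        \<forall>t1\<in>{t<..<t+\<delta>} \<inter> {0..a}. \<forall>t2\<in>{t<..<t+\<delta>} \<inter> {0..a}. norm (g t2 - g t1) \<le> \<epsilon>)"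

lemma regulated_locally_bounded:
  fixes f :: "real \<Rightarrow> 'a::real_normed_vector"
  assumes f: "f \<in> regulated a" and t: "t \<in> {0..a}"
  shows "\<exists>d>0. \<exists>M. \<forall>s\<in>{0..a}. dist s t < d \<longrightarrow> norm (f s) \<le> M"
proof -
  have R: "\<exists>d>0. \<exists>M. \<forall>s\<in>{0..a}. s > t \<longrightarrow> dist s t < d \<longrightarrow> norm (f s) \<le> M"
  proof (cases "t < a")
    case True
    with t have "t \<in> {0..<a}" by simp
    with f obtain l where "(f \<longlongrightarrow> l) (at_right t)"
      unfolding regulated_def by blast
    then have "\<forall>\<^sub>F s in at_right t. dist (f s) l < 1"
      by (rule tendstoD) simp
    then obtain d where "d > 0"
      and d: "\<And>s. s > t \<Longrightarrow> dist s t < d \<Longrightarrow> dist (f s) l < 1"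
      unfolding eventually_at by (auto simp: less_imp_neq)
    have "norm (f s) \<le> norm l + 1" if "s > t" "dist s t < d" for s
      using d[OF that] norm_triangle_ineq2[of "f s" l] by (simp add: dist_norm)
    with \<open>d > 0\<close> show ?thesis by blast
  qed (use t in \<open>intro exI[of _ 1]; simp\<close>)
  have L: "\<exists>d>0. \<exists>M. \<forall>s\<in>{0..a}. s < t \<longrightarrow> dist s t < d \<longrightarrow> norm (f s) \<le> M"
  proof (cases "0 < t")
    case True
    with t have "t \<in> {0<..a}" by simp
    with f obtain l where "(f \<longlongrightarrow> l) (at_left t)"
      unfolding regulated_def by blast
    then have "\<forall>\<^sub>F s in at_left t. dist (f s) l < 1"
      by (rule tendstoD) simp
    then obtain d where "d > 0"
      and d: "\<And>s. s < t \<Longrightarrow> dist s t < d \<Longrightarrow> dist (f s) l < 1"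
      unfolding eventually_at by (auto simp: less_imp_neq)
    have "norm (f s) \<le> norm l + 1" if "s < t" "dist s t < d" for s
      using d[OF that] norm_triangle_ineq2[of "f s" l] by (simp add: dist_norm)
    with \<open>d > 0\<close> show ?thesis by blast
  qed (use t in \<open>intro exI[of _ 1]; simp\<close>)
  from R obtain d1 M1 where 1: "d1 > 0"
    "\<And>s. s \<in> {0..a} \<Longrightarrow> s > t \<Longrightarrow> dist s t < d1 \<Longrightarrow> norm (f s) \<le> M1" by blast
  from L obtain d2 M2 where 2: "d2 > 0"
    "\<And>s. s \<in> {0..a} \<Longrightarrow> s < t \<Longrightarrow> dist s t < d2 \<Longrightarrow> norm (f s) \<le> M2" by blast
  have "norm (f s) \<le> max (norm (f t)) (max M1 M2)"
    if "s \<in> {0..a}" "dist s t < min d1 d2" for s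
    using 1(2)[of s] 2(2)[of s] that by (cases s t rule: linorder_cases) (auto simp: le_max_iff_disj)
  moreover have "min d1 d2 > 0" using 1(1) 2(1) by simp
  ultimately show ?thesis by blast
qed

lemma regulated_bounded:
  fixes f :: "real \<Rightarrow> 'a::real_normed_vector"
  assumes "f \<in> regulated a"
  shows "bounded (f ` {0..a})"
proof -
  obtain d M where d: "\<And>t. t \<in> {0..a} \<Longrightarrow> d t > 0"
    and M: "\<And>t s. t \<in> {0..a} \<Longrightarrow> s \<in> {0..a} \<Longrightarrow> dist s t < d t \<Longrightarrow> norm (f s) \<le> M t"
    using regulated_locally_bounded[OF assms] by metis
  have "{0..a} \<subseteq> (\<Union>t\<in>{0..a}. ball t (d t))"
    using d by (auto intro!: bexI)
  from compactE_image[OF compact_Icc _ this] obtain T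
    where T: "T \<subseteq> {0..a}" "finite T" "{0..a} \<subseteq> (\<Union>t\<in>T. ball t (d t))" by blast
  have "norm (f s) \<le> (\<Sum>t\<in>T. \<bar>M t\<bar>)" if s: "s \<in> {0..a}" for s
  proof -
    obtain t where t: "t \<in> T" "dist s t < d t"
      using T(3) s by (auto simp: dist_commute)
    have "norm (f s) \<le> \<bar>M t\<bar>" using M[of t s] T(1) t s by force
    also have "\<dots> \<le> (\<Sum>t\<in>T. \<bar>M t\<bar>)"
      using t(1) T(2) by (intro member_le_sum) auto
    finally show ?thesis .
  qed
  then show ?thesis unfolding bounded_iff by blast
qed

lemma mspace_regulated_space:
  "mspace (regulated_space a) = (regulated a :: (real \<Rightarrow> 'a::real_normed_vector) set)"
proof -
  have "regulated a \<subseteq> Met_TC.fspace {0..a}"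
    using regulated_bounded[of _ a] by (auto simp: Met_TC.fspace_def regulated_def)
  then show ?thesis by (auto simp: regulated_space_def)
qed

lemma mdist_regulated_space:
  fixes f g :: "real \<Rightarrow> 'a::real_normed_vector"
  assumes "0 \<le> a" "f \<in> regulated a" "g \<in> regulated a"
  shows "mdist (regulated_space a) f g = (SUP t\<in>{0..a}. norm (f t - g t))"
proof -
  have "f \<in> Met_TC.fspace {0..a}" "g \<in> Met_TC.fspace {0..a}"
    using assms mspace_regulated_space[of a, where 'a = 'a] by (auto simp: regulated_space_def)
  then show ?thesis
    using assms(1) by (simp add: regulated_space_def Met_TC.fdist_def dist_norm)
qed


section \<open>The closed dual unit ball with the norm topology\<close>

typedef (overloaded) ('a::real_normed_vector) dual_ball = "cball 0 1 :: ('a \<Rightarrow>\<^sub>L real) set"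
  morphisms functional_of Dual_ball
  by (rule exI[of _ 0]) simp

instantiation dual_ball :: (real_normed_vector) metric_space
begin

definition dist_dual_ball :: "'a dual_ball \<Rightarrow> 'a dual_ball \<Rightarrow> real" where
  "dist_dual_ball x y = dist (functional_of x) (functional_of y)"

definition uniformity_dual_ball :: "('a dual_ball \<times> 'a dual_ball) filter" where
  "uniformity_dual_ball = (INF e\<in>{0<..}. principal {(x, y). dist x y < e})"

definition open_dual_ball :: "'a dual_ball set \<Rightarrow> bool" where
  "open_dual_ball U \<longleftrightarrow> (\<forall>x\<in>U. \<forall>\<^sub>F (x', y) in uniformity. x' = x \<longrightarrow> y \<in> U)"

instance
proof
  fix x y z :: "'a dual_ball"
  show "dist x y = 0 \<longleftrightarrow> x = y"
    by (simp add: dist_dual_ball_def functional_of_inject)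
  show "dist x y \<le> dist x z + dist y z"
    by (simp add: dist_dual_ball_def dist_triangle2)
qed (simp_all add: uniformity_dual_ball_def open_dual_ball_def)

end


section \<open>The mapping \<open>\<J>\<^sub>G\<close> and strong measurability\<close>

text \<open>
  The supremum is a bounded continuous function of \<open>x\<close> whenever \<open>G\<close> is nonempty and bounded at \<open>t\<close>
  (lemma \<open>apply_sup_map\<close>); at the remaining points \<open>t\<close>, which form a null set in the intended
  application, the value is unspecified.
\<close>

definition sup_map :: "(real \<Rightarrow> 'a::real_normed_vector) set \<Rightarrow> real \<Rightarrow> ('a dual_ball \<Rightarrow>\<^sub>C real)" where
  "sup_map G t = Bcontfun (\<lambda>x. SUP g\<in>G. blinfun_apply (functional_of x) (g t))"

lemma apply_sup_map:
  fixes G :: "(real \<Rightarrow> 'a::real_normed_vector) set"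
  assumes "G \<noteq> {}" and "bdd_above ((\<lambda>g. norm (g t)) ` G)"
  shows "apply_bcontfun (sup_map G t) x = (SUP g\<in>G. blinfun_apply (functional_of x) (g t))"
proof -
  define F where "F = (\<lambda>x :: 'a dual_ball. SUP g\<in>G. blinfun_apply (functional_of x) (g t))"
  obtain M where M: "\<And>g. g \<in> G \<Longrightarrow> norm (g t) \<le> M"
    using assms(2) by (auto simp: bdd_above_def)
  have "M \<ge> 0" using M assms(1) by (meson all_not_in_conv norm_ge_zero order_trans)
  have app: "\<bar>blinfun_apply \<phi> (g t)\<bar> \<le> norm \<phi> * M" if "g \<in> G" for g and \<phi> :: "'a \<Rightarrow>\<^sub>L real"
    using norm_blinfun[of \<phi> "g t"] mult_left_mono[OF M[OF that] norm_ge_zero[of \<phi>]] by simp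
  have bdd: "bdd_above ((\<lambda>g. blinfun_apply \<phi> (g t)) ` G)" for \<phi> :: "'a \<Rightarrow>\<^sub>L real"
    using app[of _ \<phi>] by (intro bdd_aboveI2[where M = "norm \<phi> * M"]) (simp add: abs_le_iff)
  have le: "F y \<le> F z + M * dist y z" for y z
    unfolding F_def
  proof (rule cSUP_least[OF assms(1)])
    fix g assume g: "g \<in> G"
    have "blinfun_apply (functional_of y) (g t) - blinfun_apply (functional_of z) (g t)
            \<le> M * dist y z"
      using app[OF g, of "functional_of y - functional_of z"]
      by (simp add: blinfun.diff_left dist_dual_ball_def dist_norm mult.commute abs_le_iff)
    moreover have "blinfun_apply (functional_of z) (g t)
            \<le> (SUP g\<in>G. blinfun_apply (functional_of z) (g t))"
      by (rule cSUP_upper[OF g bdd])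
    ultimately show "blinfun_apply (functional_of y) (g t)
            \<le> (SUP g\<in>G. blinfun_apply (functional_of z) (g t)) + M * dist y z" by linarith
  qed
  have lip: "\<bar>F y - F z\<bar> \<le> M * dist y z" for y z
    using le[of y z] le[of z y] by (simp add: dist_commute abs_le_iff)
  then have "M-lipschitz_on UNIV F"
    using \<open>M \<ge> 0\<close> by (intro lipschitz_onI) (auto simp: dist_real_def)
  then have cont: "continuous_on UNIV F" by (rule lipschitz_on_continuous_on)
  have "\<bar>F y\<bar> \<le> M" for y
  proof -
    have 1: "norm (functional_of y) \<le> 1" using functional_of[of y] by simp
    have *: "\<bar>blinfun_apply (functional_of y) (g t)\<bar> \<le> M" if "g \<in> G" for g
      using app[OF that, of "functional_of y"] mult_right_mono[OF 1 \<open>M \<ge> 0\<close>] by simp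
    have "F y \<le> M" unfolding F_def
      by (rule cSUP_least[OF assms(1)]) (use * in \<open>simp add: abs_le_iff\<close>)
    moreover obtain g where g: "g \<in> G" using assms(1) by blast
    have "- M \<le> F y" unfolding F_def
      by (rule cSUP_upper2[OF bdd g]) (use *[OF g] in \<open>simp add: abs_le_iff\<close>)
    ultimately show ?thesis by linarith
  qed
  then have "bounded (range F)" unfolding bounded_iff by auto
  with cont have "F \<in> bcontfun" by (simp add: bcontfun_def)
  then show ?thesis by (simp add: sup_map_def F_def Bcontfun_inverse)
qed

definition strongly_measurable :: "'s measure \<Rightarrow> ('s \<Rightarrow> 'b::real_normed_vector) \<Rightarrow> bool" where
  "strongly_measurable M f \<longleftrightarrow>
     (\<exists>s :: nat \<Rightarrow> 's \<Rightarrow> 'b. (\<forall>n. simple_function M (s n)) \<and>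
        (AE t in M. (\<lambda>n. s n t) \<longlonglongrightarrow> f t))"

end

theory Submission
  imports Defs
begin

text \<open>
  By compactness of \<open>[0,a]\<close>, equi-regularity yields for each \<open>\<epsilon>\<close> finitely many intervals that cover
  \<open>[0,a]\<close> up to a finite set and on each of which all \<open>g \<in> G\<close> oscillate by at most \<open>\<epsilon>\<close>. Suprema over
  \<open>G\<close> then oscillate by at most \<open>\<epsilon>\<close> too, uniformly on the dual ball, so \<open>\<J>\<^sub>G\<close> is almost everywhere
  within \<open>\<epsilon>\<close> of a step function.
\<close>

text \<open>Overlaps in \<open>\<A>\<close> are harmless: each induction step overwrites the simple
  function built so far by the constant belonging to the new set, and on the overlap either value is
  within \<open>e\<close> of \<open>f\<close>.\<close>

lemma simple_function_approx_on_finite_Union: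
  fixes f :: "'s \<Rightarrow> 'b::real_normed_vector"
  assumes "finite \<A>" "\<A> \<subseteq> sets M"
    and "\<And>A. A \<in> \<A> \<Longrightarrow> \<exists>c. AE t in M. t \<in> A \<longrightarrow> dist (f t) c \<le> e"
  shows "\<exists>s. simple_function M s \<and> (AE t in M. t \<in> \<Union>\<A> \<longrightarrow> dist (f t) (s t) \<le> e)"
  using assms
proof (induction \<A> rule: finite_induct)
  case empty
  show ?case by (intro exI[of _ "\<lambda>_. 0"]) simp
next
  case (insert A \<A>)
  then obtain s where s: "simple_function M s" "AE t in M. t \<in> \<Union>\<A> \<longrightarrow> dist (f t) (s t) \<le> e"
    by auto
  obtain c where c: "AE t in M. t \<in> A \<longrightarrow> dist (f t) c \<le> e"
    using insert.prems(2) by blast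
  have A: "A \<in> sets M" using insert.prems(1) by simp
  then have "A \<inter> space M \<in> sets M" by auto
  then have "simple_function M (\<lambda>t. if t \<in> A then c else s t)"
    using s(1) by (intro simple_function_If_set) auto
  moreover have "AE t in M. t \<in> \<Union>(insert A \<A>) \<longrightarrow> dist (f t) (if t \<in> A then c else s t) \<le> e"
    using s(2) c by eventually_elim auto
  ultimately show ?case by blast
qed

lemma strongly_measurable_if_almost_piecewise_constant:
  fixes f :: "'s \<Rightarrow> 'b::real_normed_vector"
  assumes "\<And>e. e > 0 \<Longrightarrow> \<exists>\<A>. finite \<A> \<and> \<A> \<subseteq> sets M \<and> (AE t in M. t \<in> \<Union>\<A>) \<and>
      (\<forall>A\<in>\<A>. \<exists>c. AE t in M. t \<in> A \<longrightarrow> dist (f t) c \<le> e)"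
  shows "strongly_measurable M f"
proof -
  have "\<exists>s. simple_function M s \<and> (AE t in M. dist (f t) (s t) \<le> e)" if e: "e > 0" for e
  proof -
    obtain \<A> where \<A>: "finite \<A>" "\<A> \<subseteq> sets M" "AE t in M. t \<in> \<Union>\<A>"
      "\<And>A. A \<in> \<A> \<Longrightarrow> \<exists>c. AE t in M. t \<in> A \<longrightarrow> dist (f t) c \<le> e"
      using assms[OF e] by blast
    obtain s where s: "simple_function M s" "AE t in M. t \<in> \<Union>\<A> \<longrightarrow> dist (f t) (s t) \<le> e"
      using simple_function_approx_on_finite_Union[OF \<A>(1,2,4)] by blast
    have "AE t in M. dist (f t) (s t) \<le> e" using \<A>(3) s(2) by eventually_elim blast
    with s(1) show ?thesis by blast
  qed
  then have "\<exists>s. simple_function M s \<and> (AE t in M. dist (f t) (s t) \<le> inverse (real (Suc n)))"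
    for n by simp
  then obtain s where s: "\<And>n. simple_function M (s n)"
    "\<And>n. AE t in M. dist (f t) (s n t) \<le> inverse (real (Suc n))"
    by metis
  \<comment> \<open>The exceptional null sets, one for each \<open>n\<close>, are merged into a
    single one, so that the limit can be taken pointwise outside it.\<close>
  have "AE t in M. \<forall>n. dist (f t) (s n t) \<le> inverse (real (Suc n))"
    using s(2) by (simp add: AE_all_countable)
  then have "AE t in M. (\<lambda>n. s n t) \<longlonglongrightarrow> f t"
  proof eventually_elim
    case (elim t)
    have "(\<lambda>n. dist (s n t) (f t)) \<longlonglongrightarrow> 0"
      by (rule tendsto_sandwich[OF _ _ tendsto_const LIMSEQ_inverse_real_of_nat])
        (use elim in \<open>auto simp: dist_commute\<close>)
    then show ?case by (rule tendsto_dist_iff[THEN iffD2])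
  qed
  with s(1) show ?thesis unfolding strongly_measurable_def by blast
qed

text \<open>Functionals in the dual ball have norm at most 1, so moving from \<open>r\<close> to
  \<open>t\<close> changes each pairing with \<open>g\<close> by at most \<open>e\<close>, uniformly
  in the functional and in \<open>g\<close>. Such a bound survives the supremum over
  \<open>g\<close> and then the sup-norm over the ball.\<close>

lemma dist_sup_map_le:
  fixes G :: "(real \<Rightarrow> 'a::real_normed_vector) set"
  assumes ne: "G \<noteq> {}"
    and bdd: "bdd_above ((\<lambda>g. norm (g t)) ` G)" "bdd_above ((\<lambda>g. norm (g r)) ` G)"
    and osc: "\<And>g. g \<in> G \<Longrightarrow> norm (g t - g r) \<le> e"
  shows "dist (sup_map G t) (sup_map G r) \<le> e"
proof -
  have app: "blinfun_apply (functional_of x) v \<le> norm v" for x :: "'a dual_ball" and v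
  proof -
    have "norm (functional_of x) \<le> 1" using functional_of[of x] by simp
    then have "norm (functional_of x) * norm v \<le> norm v" by (simp add: mult_left_le_one_le)
    then show ?thesis using norm_blinfun[of "functional_of x" v] by (simp add: abs_le_iff)
  qed
  \<comment> \<open>One-sided estimate for arbitrary points, to be used for \<open>t\<close>,
    \<open>r\<close> and again with the two exchanged.\<close>
  have le: "apply_bcontfun (sup_map G p) x \<le> apply_bcontfun (sup_map G q) x + e"
    if p: "bdd_above ((\<lambda>g. norm (g p)) ` G)" and q: "bdd_above ((\<lambda>g. norm (g q)) ` G)"
      and pq: "\<And>g. g \<in> G \<Longrightarrow> norm (g p - g q) \<le> e" for p q x
    unfolding apply_sup_map[OF ne p] apply_sup_map[OF ne q]
  proof (rule cSUP_least[OF ne])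
    fix g assume g: "g \<in> G"
    \<comment> \<open>Boundedness at \<open>q\<close> is what makes the real supremum there a
      genuine upper bound.\<close>
    obtain M where "\<And>g. g \<in> G \<Longrightarrow> norm (g q) \<le> M" using q by (auto simp: bdd_above_def)
    then have "bdd_above ((\<lambda>g. blinfun_apply (functional_of x) (g q)) ` G)"
      using app[of x] by (meson bdd_aboveI2 order_trans)
    from cSUP_upper[OF g this] app[of x "g p - g q"] pq[OF g]
    show "blinfun_apply (functional_of x) (g p)
        \<le> (SUP g\<in>G. blinfun_apply (functional_of x) (g q)) + e"
      by (simp add: blinfun.diff_right)
  qed
  have "norm (g r - g t) \<le> e" if "g \<in> G" for g
    using osc[OF that] by (simp add: norm_minus_commute)
  then show ?thesis
    using le[OF bdd osc] le[OF bdd(2,1)]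
    by (intro dist_bound) (simp add: dist_real_def abs_le_iff algebra_simps)
qed

text \<open>Puts both sides of \<open>t\<close> under one radius, the smaller of the two. At an
  endpoint the outer interval misses \<open>{0..a}\<close>, so there the radius 1 works
  vacuously.\<close>

lemma equi_regulated_one_sided:
  assumes "equi_regulated a G" "e > 0" "t \<in> {0..a}"
  shows "\<exists>d>0. \<forall>A\<in>{{t-d<..<t} \<inter> {0..a}, {t<..<t+d} \<inter> {0..a}}.
    \<forall>g\<in>G. \<forall>p\<in>A. \<forall>q\<in>A. norm (g p - g q) \<le> e"
proof -
  have "\<exists>d>0. \<forall>g\<in>G. \<forall>q\<in>{t-d<..<t} \<inter> {0..a}. \<forall>p\<in>{t-d<..<t} \<inter> {0..a}. norm (g p - g q) \<le> e"
  proof (cases "t = 0")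
    case False
    with assms show ?thesis unfolding equi_regulated_def by simp
  qed (auto intro: exI[of _ 1])
  then obtain d1 where d1: "d1 > 0"
    "\<And>g p q. g \<in> G \<Longrightarrow> p \<in> {t-d1<..<t} \<inter> {0..a} \<Longrightarrow> q \<in> {t-d1<..<t} \<inter> {0..a} \<Longrightarrow> norm (g p - g q) \<le> e"
    by blast
  have "\<exists>d>0. \<forall>g\<in>G. \<forall>q\<in>{t<..<t+d} \<inter> {0..a}. \<forall>p\<in>{t<..<t+d} \<inter> {0..a}. norm (g p - g q) \<le> e"
  proof (cases "t = a")
    case False
    with assms show ?thesis unfolding equi_regulated_def by simp
  qed (auto intro: exI[of _ 1])
  then obtain d2 where d2: "d2 > 0"
    "\<And>g p q. g \<in> G \<Longrightarrow> p \<in> {t<..<t+d2} \<inter> {0..a} \<Longrightarrow> q \<in> {t<..<t+d2} \<inter> {0..a} \<Longrightarrow> norm (g p - g q) \<le> e"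
    by blast
  show ?thesis
    using d1 d2 by (intro exI[of _ "min d1 d2"]) auto
qed

text \<open>The one-sided intervals leave out their centre \<open>t\<close>, where the functions may
  jump. Compactness is therefore applied to the full balls, and removing the finitely many centres
  afterwards loses only a finite set.\<close>

lemma equi_regulated_finite_cover:
  assumes "equi_regulated a G" "e > 0"
  shows "\<exists>\<A>. finite \<A> \<and> \<A> \<subseteq> sets (lebesgue_on {0..a}) \<and> finite ({0..a} - \<Union>\<A>) \<and>
    (\<forall>A\<in>\<A>. \<forall>g\<in>G. \<forall>p\<in>A. \<forall>q\<in>A. norm (g p - g q) \<le> e)"
proof -
  define \<I> where "\<I> t d = {{t-d<..<t} \<inter> {0..a}, {t<..<t+d} \<inter> {0..a}}" for t d :: real
  obtain d where d: "\<And>t. t \<in> {0..a} \<Longrightarrow> d t > 0"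
    and osc: "\<And>t. t \<in> {0..a} \<Longrightarrow> \<forall>A\<in>\<I> t (d t). \<forall>g\<in>G. \<forall>p\<in>A. \<forall>q\<in>A. norm (g p - g q) \<le> e"
    using equi_regulated_one_sided[OF assms] unfolding \<I>_def by metis
  have "{0..a} \<subseteq> (\<Union>t\<in>{0..a}. ball t (d t))"
    using d by (auto intro!: bexI)
  from compactE_image[OF compact_Icc _ this] obtain T
    where T: "T \<subseteq> {0..a}" "finite T" "{0..a} \<subseteq> (\<Union>t\<in>T. ball t (d t))" by blast
  define \<A> where "\<A> = (\<Union>t\<in>T. \<I> t (d t))"
  have "finite \<A>" using T(2) by (simp add: \<A>_def \<I>_def)
  moreover have "\<A> \<subseteq> sets (lebesgue_on {0..a})"
    by (auto simp: \<A>_def \<I>_def sets_restrict_space_iff)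
  \<comment> \<open>Within \<open>{0..a}\<close>, a ball without its centre is the union of its two
    one-sided intervals, so only centres can remain uncovered.\<close>
  moreover have "{0..a} - \<Union>\<A> \<subseteq> T"
  proof (rule subsetI, rule ccontr)
    fix s assume s: "s \<in> {0..a} - \<Union>\<A>" "s \<notin> T"
    then have "s \<in> (\<Union>t\<in>T. ball t (d t))" using T(3) by blast
    then obtain t where t: "t \<in> T" "dist t s < d t" by auto
    with s(2) have "t \<noteq> s" by auto
    with s(1) t(2) have "s \<in> \<Union>(\<I> t (d t))" by (auto simp: \<I>_def dist_real_def)
    with s(1) t(1) show False by (auto simp: \<A>_def)
  qed
  then have "finite ({0..a} - \<Union>\<A>)" using T(2) by (rule finite_subset)
  moreover have "\<forall>A\<in>\<A>. \<forall>g\<in>G. \<forall>p\<in>A. \<forall>q\<in>A. norm (g p - g q) \<le> e"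
    using osc T(1) unfolding \<A>_def by blast
  ultimately show ?thesis by blast
qed

theorem theorem5p7:
  fixes a :: real and G :: "(real \<Rightarrow> 'a::banach) set"
  assumes "\<nexists>B :: 'a set. finite_dimensional_vector_space (*\<^sub>R) B"
    and "a > 0"
    and "equi_regulated a G"
    and "separable_space (subtopology (mtopology_of (regulated_space a)) G)"
    and "AE t in lebesgue_on {0..a}. bdd_above ((\<lambda>g. norm (g t)) ` G)"
  shows "strongly_measurable (lebesgue_on {0..a}) (sup_map G)"
proof (rule strongly_measurable_if_almost_piecewise_constant)
  let ?M = "lebesgue_on {0..a}"
  fix e :: real assume "e > 0"
  from equi_regulated_finite_cover[OF assms(3) this] obtain \<A>
    where \<A>: "finite \<A>" "\<A> \<subseteq> sets ?M" "finite ({0..a} - \<Union>\<A>)"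
      and osc: "\<forall>A\<in>\<A>. \<forall>g\<in>G. \<forall>p\<in>A. \<forall>q\<in>A. norm (g p - g q) \<le> e"
    by (elim exE conjE)
  have ne: "G \<noteq> {}" using assms(3) by (simp add: equi_regulated_def)
  have "{0..a} - \<Union>\<A> \<in> null_sets lebesgue"
    using negligible_finite[OF \<A>(3)] by (simp add: negligible_iff_null_sets)
  then have "AE t in lebesgue. t \<notin> {0..a} - \<Union>\<A>" by (rule AE_not_in)
  then have cover: "AE t in ?M. t \<in> \<Union>\<A>"
    by (subst AE_restrict_space_iff) auto
  \<comment> \<open>The approximating constant is the value of \<open>sup_map G\<close> at a sample
    point \<open>r\<close> of \<open>A\<close>. This \<open>r\<close> must be a point where
    \<open>G\<close> is bounded, since elsewhere the value of \<open>sup_map\<close> is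
    unspecified.\<close>
  have "\<exists>c. AE t in ?M. t \<in> A \<longrightarrow> dist (sup_map G t) c \<le> e" if A: "A \<in> \<A>" for A
  proof (cases "\<exists>r\<in>A. bdd_above ((\<lambda>g. norm (g r)) ` G)")
    case True
    then obtain r where r: "r \<in> A" "bdd_above ((\<lambda>g. norm (g r)) ` G)" by blast
    have "AE t in ?M. t \<in> A \<longrightarrow> dist (sup_map G t) (sup_map G r) \<le> e"
      using assms(5)
    proof eventually_elim
      case (elim t)
      show ?case using dist_sup_map_le[OF ne elim r(2)] osc A r(1) by blast
    qed
    then show ?thesis by blast
  next
    case False
    \<comment> \<open>Here \<open>G\<close> is unbounded at every point of \<open>A\<close>, so
      almost every \<open>t\<close> lies outside \<open>A\<close> and the constant 0 is an arbitrary
      choice.\<close>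
    then have "AE t in ?M. t \<in> A \<longrightarrow> dist (sup_map G t) 0 \<le> e"
      using assms(5) by (auto elim: eventually_mono)
    then show ?thesis by blast
  qed
  with \<A>(1,2) cover show "\<exists>\<A>. finite \<A> \<and> \<A> \<subseteq> sets ?M \<and> (AE t in ?M. t \<in> \<Union>\<A>) \<and>
      (\<forall>A\<in>\<A>. \<exists>c. AE t in ?M. t \<in> A \<longrightarrow> dist (sup_map G t) c \<le> e)"
    by blast
qed

end
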